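(* Let $N\ge 3$, $1\le r\le N$, let $R$ be a set of $r$ rim vertices of the wheel graph $W_{N+1}$ with central vertex $c$, and let $d_1,\ldots,d_r$ be the cyclic intervals of $R$. Then $$\mathcal F_{W_{N+1}}(\{c\}\cup R)=\prod_{i=1}^{r}m(P_{2d_i-1}),$$ where $m(P_n)$ denotes the number of matchings of the path graph $P_n$ on $n$ vertices.
   Context: The wheel graph $W_{N+1}$ ($N\ge3$) has vertex set $\{c,v_1,\ldots,v_N\}$ and edges $\{v_i,v_{i+1}\}$ (indices modulo $N$) and $\{c,v_i\}$ for $1\le i\le N$; $c$ is the central vertex and the $v_i$ are the rim vertices. For a set $R=\{v_{a_1},\ldots,v_{a_r}\}$ of rim vertices with $1\le a_1<\cdots<a_r\le N$, the cyclic intervals are $d_i=a_{i+1}-a_i$ for $1\le i\le r-1$ and $d_r=a_1+N-a_r$. For a finite connected graph $G$ and $\varnothing\ne S\subseteq V(G)$, a rooted spanning forest of $G$ with root set $S$ is a spanning forest (an acyclic subgraph containing all vertices of $G$) in which each connected component contains exactly one vertex of $S$; $\mathcal F_G(S)$ denotes the number of such forests. A matching of a graph is a set of edges no two of which share an endpoint; the empty set is a matching. *)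

theory Defs
  imports Main
begin

section \<open>Simple undirected graphs\<close>

text \<open>A graph is a pair of a vertex set and a set of edges, an edge being a two-element set
  of vertices.\<close>

type_synonym 'a graph = "'a set \<times> 'a set set"

abbreviation verts :: "'a graph \<Rightarrow> 'a set" where
  "verts \<equiv> fst"

abbreviation edges :: "'a graph \<Rightarrow> 'a set set" where
  "edges \<equiv> snd"

definition simple_graph :: "'a graph \<Rightarrow> bool" where
  "simple_graph G \<longleftrightarrow> (\<forall>e\<in>edges G. e \<subseteq> verts G \<and> card e = 2)"

definition subgraph :: "'a graph \<Rightarrow> 'a graph \<Rightarrow> bool" where
  "subgraph H G \<longleftrightarrow> simple_graph H \<and> verts H \<subseteq> verts G \<and> edges H \<subseteq> edges G"

definition adjacent :: "'a graph \<Rightarrow> 'a \<Rightarrow> 'a \<Rightarrow> bool" where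
  "adjacent G u v \<longleftrightarrow> {u, v} \<in> edges G"

definition component_of :: "'a graph \<Rightarrow> 'a \<Rightarrow> 'a set" where
  "component_of G u = {v \<in> verts G. (adjacent G)\<^sup>*\<^sup>* u v}"

definition components :: "'a graph \<Rightarrow> 'a set set" where
  "components G = component_of G ` verts G"

definition connected_graph :: "'a graph \<Rightarrow> bool" where
  "connected_graph G \<longleftrightarrow> verts G \<noteq> {} \<and> (\<forall>u\<in>verts G. \<forall>v\<in>verts G. (adjacent G)\<^sup>*\<^sup>* u v)"

text \<open>A cycle is given by the list of its vertices, without repeating the start vertex at
  the end.\<close>

definition is_cycle :: "'a graph \<Rightarrow> 'a list \<Rightarrow> bool" where
  "is_cycle G vs \<longleftrightarrow> length vs \<ge> 3 \<and> distinct vs \<and>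
     (\<forall>i<length vs. adjacent G (vs ! i) (vs ! (Suc i mod length vs)))"

definition acyclic_graph :: "'a graph \<Rightarrow> bool" where
  "acyclic_graph G \<longleftrightarrow> (\<nexists>vs. is_cycle G vs)"


section \<open>Rooted spanning forests and matchings\<close>

definition spanning_forest :: "'a graph \<Rightarrow> 'a graph \<Rightarrow> bool" where
  "spanning_forest G F \<longleftrightarrow> subgraph F G \<and> verts F = verts G \<and> acyclic_graph F"

definition rooted_spanning_forest :: "'a graph \<Rightarrow> 'a set \<Rightarrow> 'a graph \<Rightarrow> bool" where
  "rooted_spanning_forest G S F \<longleftrightarrow>
     spanning_forest G F \<and> (\<forall>C\<in>components F. \<exists>!s. s \<in> S \<and> s \<in> C)"

definition num_rooted_forests :: "'a graph \<Rightarrow> 'a set \<Rightarrow> nat" where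
  "num_rooted_forests G S = card {F. rooted_spanning_forest G S F}"

definition matching :: "'a graph \<Rightarrow> 'a set set \<Rightarrow> bool" where
  "matching G M \<longleftrightarrow> M \<subseteq> edges G \<and> (\<forall>e\<in>M. \<forall>f\<in>M. e \<noteq> f \<longrightarrow> e \<inter> f = {})"

definition num_matchings :: "'a graph \<Rightarrow> nat" where
  "num_matchings G = card {M. matching G M}"


section \<open>Paths and wheels\<close>

definition path_graph :: "nat \<Rightarrow> nat graph" where
  "path_graph n = ({1..n}, {{i, i + 1} | i. 1 \<le> i \<and> i < n})"

datatype wheel_vertex = Center | Rim nat

definition rim_vertices :: "nat \<Rightarrow> wheel_vertex set" where
  "rim_vertices N = Rim ` {1..N}"

text \<open>The argument is the number of rim vertices: \<open>wheel_graph N\<close> is $W_{N+1}$. The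
  successor of rim index \<open>i\<close> in the cyclic order on $1, \ldots, N$ is \<open>i mod N + 1\<close>.\<close>

definition wheel_graph :: "nat \<Rightarrow> wheel_vertex graph" where
  "wheel_graph N =
     (insert Center (rim_vertices N),
      {{Rim i, Rim (i mod N + 1)} | i. i \<in> {1..N}} \<union> {{Center, Rim i} | i. i \<in> {1..N}})"

text \<open>\<open>rim_index R i\<close> is the \<open>i\<close>-th smallest index $a_i$ of a vertex in \<open>R\<close>, counting
  from $i = 1$.\<close>

definition rim_index :: "wheel_vertex set \<Rightarrow> nat \<Rightarrow> nat" where
  "rim_index R i = sorted_list_of_set {j. Rim j \<in> R} ! (i - 1)"

definition cyclic_interval :: "nat \<Rightarrow> wheel_vertex set \<Rightarrow> nat \<Rightarrow> nat" where
  "cyclic_interval N R i =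
     (if i < card R then rim_index R (i + 1) - rim_index R i
      else rim_index R 1 + N - rim_index R (card R))"


lemma simple_graph_path: "simple_graph (path_graph n)"
  by (auto simp: simple_graph_def path_graph_def)

lemma simple_graph_wheel:
  assumes "N \<ge> 3"
  shows "simple_graph (wheel_graph N)"
proof -
  have "i mod N + 1 \<noteq> i \<and> i mod N + 1 \<in> {1..N}" if "i \<in> {1..N}" for i
    using assms that by (cases "i = N") (auto simp: Suc_le_eq)
  then show ?thesis
    by (fastforce simp: simple_graph_def wheel_graph_def rim_vertices_def card_2_iff)
qed

lemma card_verts_wheel: "card (verts (wheel_graph N)) = N + 1"
proof -
  have "card (rim_vertices N) = N"
    by (simp add: rim_vertices_def card_image inj_on_def)
  moreover have "Center \<notin> rim_vertices N" "finite (rim_vertices N)"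
    by (auto simp: rim_vertices_def)
  ultimately show ?thesis
    by (simp add: wheel_graph_def)
qed

lemma connected_wheel: "connected_graph (wheel_graph N)"
proof -
  let ?A = "adjacent (wheel_graph N)"
  have "?A\<^sup>*\<^sup>* u Center \<and> ?A\<^sup>*\<^sup>* Center u" if "u \<in> verts (wheel_graph N)" for u
  proof (cases "u = Center")
    case False
    then have "?A u Center" "?A Center u"
      using that by (auto simp: adjacent_def wheel_graph_def rim_vertices_def insert_commute)
    then show ?thesis by blast
  qed simp
  moreover have "verts (wheel_graph N) \<noteq> {}"
    by (simp add: wheel_graph_def)
  ultimately show ?thesis
    unfolding connected_graph_def by (meson rtranclp_trans)
qed

end

theory Submission
  imports Defs "HOL-Library.Disjoint_Sets"
begin

text \<open>Going around the wheel, spokes and rim edges alternate. Mark the rim edges missing from an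
  edge set, the spokes belonging to it, and the (never used) spokes at the vertices of $R$. Two
  consecutive marked spokes join two roots or close a cycle, and two consecutive marked rim edges
  cut off an arc without a root; so the rooted forests are exactly the edge sets for which marked
  spokes and marked rim edges alternate. As positions alternate in kind, this says that every gap
  between consecutive marks is of even length. The condition splits over the intervals of $R$. An
  interval $d$ has $2d - 1$ positions, and the unmarked ones fall into gaps of even length, each
  of which is tiled by dominoes in just one way: they are the vertices covered by a unique
  matching of $P_{2d-1}$.\<close>

section \<open>Positions around the wheel\<close>

text \<open>The rim is unrolled onto the integers: every integer is a rim index, a turn has
  \<open>2 * N\<close> positions, and the marks form a periodic set. Being consecutive is then a
  matter of the linear order, with no special case for the seam between \<open>N\<close> and 1, nor
  for a single root, whose interval runs once round back to itself. Counting the spokes at the roots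
  as marks puts a mark at both ends of every interval, which is what makes the condition split
  there. The less obvious direction is that alternation yields a forest. Each rim index then has
  exactly one attachment point on its arc; the distance to that point rules out cycles, and the root
  behind it labels the components. No bijection with matchings is built: both families are shown to
  obey the Fibonacci recurrence with the same initial values.\<close>

definition rim_at :: "nat \<Rightarrow> int \<Rightarrow> wheel_vertex" where
  "rim_at N k = Rim (nat ((k - 1) mod int N) + 1)"

text \<open>Spokes and rim edges alternate around the wheel: the spoke at rim vertex \<open>k\<close> has position
  \<open>2 * k - 1\<close>, and the rim edge from \<open>k\<close> to \<open>k + 1\<close> has position \<open>2 * k\<close>.\<close>

definition slot :: "nat \<Rightarrow> int \<Rightarrow> wheel_vertex set" where
  "slot N p = (if even p then {rim_at N (p div 2), rim_at N (p div 2 + 1)}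
               else {Center, rim_at N ((p + 1) div 2)})"

text \<open>The even marks are the rim edges missing from \<open>D\<close>. The odd marks are the points where a
  rim arc is attached to a root, either through its spoke or by being a root itself.\<close>

definition marks :: "nat \<Rightarrow> wheel_vertex set \<Rightarrow> wheel_vertex set set \<Rightarrow> int set" where
  "marks N R D = {p. if even p then slot N p \<notin> D
                     else slot N p \<in> D \<or> rim_at N ((p + 1) div 2) \<in> R}"

text \<open>Only consecutive elements are compared, so the condition makes sense for sets unbounded
  both ways and can be tested separately on intervals whose ends belong to the set.\<close>

definition alternating :: "int set \<Rightarrow> bool" where
  "alternating Y \<longleftrightarrow>
     (\<forall>p\<in>Y. \<forall>q\<in>Y. p < q \<and> Y \<inter> {p<..<q} = {} \<longrightarrow> odd (q - p))"

lemma alternatingD: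
  "\<lbrakk>alternating Y; p \<in> Y; q \<in> Y; p < q; Y \<inter> {p<..<q} = {}\<rbrakk> \<Longrightarrow> odd (q - p)"
  by (auto simp: alternating_def)

lemma slot_even: "slot N (2 * k) = {rim_at N k, rim_at N (k + 1)}"
  by (simp add: slot_def)

lemma slot_odd: "slot N (2 * k - 1) = {Center, rim_at N k}"
  by (simp add: slot_def)

lemma slot_cases:
  obtains k where "p = 2 * k" | k where "p = 2 * k - (1::int)"
proof (cases "even p")
  case False
  then obtain k where "p = 2 * k + 1" by (elim oddE)
  then have "p = 2 * (k + 1) - 1" by simp
  then show ?thesis by (rule that(2))
qed (use that(1) in \<open>auto elim: evenE\<close>)

lemma mem_marks_even: "2 * k \<in> marks N R D \<longleftrightarrow> {rim_at N k, rim_at N (k + 1)} \<notin> D"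
  by (simp add: marks_def slot_even)

lemma mem_marks_odd:
  "2 * k - 1 \<in> marks N R D \<longleftrightarrow> {Center, rim_at N k} \<in> D \<or> rim_at N k \<in> R"
  by (simp add: marks_def slot_odd)

lemma rim_at_neq_Center [simp]: "rim_at N k \<noteq> Center" "Center \<noteq> rim_at N k"
  by (simp_all add: rim_at_def)

lemma rim_at_eq_iff:
  assumes "N \<ge> 1" shows "rim_at N k = rim_at N l \<longleftrightarrow> int N dvd k - l"
proof -
  have "rim_at N k = rim_at N l \<longleftrightarrow> (k - 1) mod int N = (l - 1) mod int N"
    using assms by (auto simp: rim_at_def eq_nat_nat_iff)
  then show ?thesis by (simp add: mod_eq_dvd_iff)
qed

lemma rim_at_int: "j \<in> {1..N} \<Longrightarrow> rim_at N (int j) = Rim j"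
  by (auto simp: rim_at_def nat_mod_distrib of_nat_diff)

lemma range_rim_at:
  assumes "N \<ge> 1" shows "range (rim_at N) = rim_vertices N"
proof -
  have "nat ((k - 1) mod int N) < N" for k
    using assms pos_mod_bound[of "int N" "k - 1"] by linarith
  then have "rim_at N k \<in> rim_vertices N" for k
    by (auto simp: rim_at_def rim_vertices_def Suc_le_eq)
  moreover have "v \<in> range (rim_at N)" if "v \<in> rim_vertices N" for v
    using that by (auto simp: rim_vertices_def simp flip: rim_at_int)
  ultimately show ?thesis by blast
qed

lemma edges_wheel_eq_range_slot:
  assumes "N \<ge> 1" shows "edges (wheel_graph N) = range (slot N)"
proof -
  have succ: "rim_at N (int i + 1) = Rim (i mod N + 1)" for i
    by (simp add: rim_at_def nat_mod_distrib flip: of_nat_mod)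
  have sp: "\<exists>j\<in>{1..N}. rim_at N k = Rim j \<and> rim_at N (k + 1) = Rim (j mod N + 1)" for k
  proof -
    obtain j where j: "j \<in> {1..N}" "rim_at N k = Rim j"
      using range_rim_at[OF assms] rangeI[of "rim_at N" k] unfolding rim_vertices_def by blast
    then have "rim_at N k = rim_at N (int j)" by (simp only: rim_at_int)
    then have "rim_at N (k + 1) = rim_at N (int j + 1)"
      using assms by (simp add: rim_at_eq_iff)
    then show ?thesis using j succ by auto
  qed
  have "slot N p \<in> edges (wheel_graph N)" for p
  proof (cases p rule: slot_cases)
    case (1 k)
    then show ?thesis using sp[of k] by (auto simp: slot_even wheel_graph_def)
  next
    case (2 k)
    then show ?thesis using sp[of k] by (auto simp: slot_odd wheel_graph_def)
  qed
  moreover have "e \<in> range (slot N)" if "e \<in> edges (wheel_graph N)" for e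
  proof -
    consider i where "i \<in> {1..N}" "e = {Rim i, Rim (i mod N + 1)}"
      | i where "i \<in> {1..N}" "e = {Center, Rim i}"
      using \<open>e \<in> edges (wheel_graph N)\<close> by (auto simp: wheel_graph_def)
    then show ?thesis
    proof cases
      case 1
      then have "e = slot N (2 * int i)" by (simp add: slot_even succ rim_at_int)
      then show ?thesis by simp
    next
      case 2
      then have "e = slot N (2 * int i - 1)" by (simp add: slot_odd rim_at_int)
      then show ?thesis by simp
    qed
  qed
  ultimately show ?thesis by blast
qed

text \<open>Two rim edges could also agree crosswise, each start being the other's end; then
  \<open>N\<close> would divide 2, which \<open>N \<ge> 3\<close> excludes. With two rim vertices,
  positions 2 and 4 would indeed carry the same edge.\<close>

lemma slot_eq_iff:
  assumes "N \<ge> 3" shows "slot N p = slot N q \<longleftrightarrow> 2 * int N dvd p - q"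
proof -
  note iff = rim_at_eq_iff[of N]
  have "\<not> int N dvd 2"
    using assms zdvd_imp_le[of "int N" 2] by auto
  then have nocross: "\<not> (int N dvd k - (l + 1) \<and> int N dvd k + 1 - l)" for k l
    using dvd_diff[of "int N" "k + 1 - l" "k - (l + 1)"] by auto
  have N1: "N \<ge> 1" using assms by simp
  have half: "2 * int N dvd 2 * k - 2 * l \<longleftrightarrow> int N dvd k - l" for k l
    using dvd_mult_cancel_left[of 2 "int N" "k - l"] by (simp add: right_diff_distrib)
  show ?thesis
  proof (cases p rule: slot_cases; cases q rule: slot_cases)
    fix k l assume "p = 2 * k" "q = 2 * l"
    then show ?thesis
      using nocross[of k l] by (auto simp: slot_even doubleton_eq_iff iff[OF N1] half)
  next
    fix k l assume "p = 2 * k" "q = 2 * l - 1"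
    moreover then have "odd (p - q)" by simp
    then have "\<not> 2 * int N dvd p - q" by (meson dvd_mult_left)
    ultimately show ?thesis by (auto simp: slot_even slot_odd doubleton_eq_iff)
  next
    fix k l assume "p = 2 * k - 1" "q = 2 * l"
    moreover then have "odd (p - q)" by simp
    then have "\<not> 2 * int N dvd p - q" by (meson dvd_mult_left)
    ultimately show ?thesis by (auto simp: slot_even slot_odd doubleton_eq_iff)
  next
    fix k l assume "p = 2 * k - 1" "q = 2 * l - 1"
    then show ?thesis
      by (auto simp: slot_odd doubleton_eq_iff iff[OF N1] half)
  qed
qed

text \<open>Shifting by whole turns later brings any pair of consecutive marks into the interval of
  one root.\<close>

lemma marks_periodic:
  assumes "N \<ge> 3" shows "p + 2 * int N * m \<in> marks N R D \<longleftrightarrow> p \<in> marks N R D"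
proof -
  have s: "rim_at N (k + int N * m) = rim_at N k" for k
    using assms by (simp add: rim_at_eq_iff)
  show ?thesis
  proof (cases p rule: slot_cases)
    case (1 k)
    then show ?thesis
      using mem_marks_even[of "k + int N * m" N R D] s[of k] s[of "k + 1"] mem_marks_even[of k N R D]
      by (simp add: algebra_simps)
  next
    case (2 k)
    then show ?thesis
      using mem_marks_odd[of "k + int N * m" N R D] s[of k] mem_marks_odd[of k N R D]
      unfolding 2 by (simp add: algebra_simps)
  qed
qed

section \<open>Matchings of paths\<close>

text \<open>The added ends 0 and \<open>n + 1\<close> act as sentinels: they force the gaps before
  the first and after the last element to be even as well.\<close>

definition even_gap_sets :: "nat \<Rightarrow> int set set" where
  "even_gap_sets n = {X. X \<subseteq> {1..int n} \<and> alternating (insert (int n + 1) (insert 0 X))}"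

text \<open>A new largest element is consecutive only to the old maximum \<open>m\<close>, so just
  one parity condition is added.\<close>

lemma alternating_insert_top:
  assumes "m \<in> Y" "\<And>y. y \<in> Y \<Longrightarrow> y \<le> m" "m < b"
  shows "alternating (insert b Y) \<longleftrightarrow> alternating Y \<and> odd (b - m)"
proof (intro iffI conjI)
  assume L: "alternating (insert b Y)"
  have "insert b Y \<inter> {m<..<b} = {}" using assms(2) by force
  then show "odd (b - m)"
    using assms by (intro alternatingD[OF L]) auto
  show "alternating Y"
    unfolding alternating_def
  proof (intro ballI impI)
    fix p q assume "p \<in> Y" "q \<in> Y" "p < q \<and> Y \<inter> {p<..<q} = {}"
    moreover then have "b \<notin> {p<..<q}" using assms(2)[of q] assms(3) by auto
    ultimately show "odd (q - p)" by (intro alternatingD[OF L]) auto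
  qed
next
  assume R: "alternating Y \<and> odd (b - m)"
  show "alternating (insert b Y)"
    unfolding alternating_def
  proof (intro ballI impI)
    fix p q assume pq: "p \<in> insert b Y" "q \<in> insert b Y" "p < q \<and> insert b Y \<inter> {p<..<q} = {}"
    have le: "y \<le> m" "y < b" if "y \<in> Y" for y using assms(2)[OF that] assms(3) by auto
    show "odd (q - p)"
    proof (cases "q = b")
      case True
      then have "p \<in> Y" using pq by auto
      then have "p = m" using le(1)[of p] pq True assms by force
      then show ?thesis using R True by simp
    next
      case False
      then have "q \<in> Y" "p \<in> Y" using pq le(2)[of q] by auto
      then show ?thesis using R pq by (intro alternatingD[of Y]) auto
    qed
  qed
qed

lemma even_gap_sets_0: "even_gap_sets 0 = {{}}"
  using alternating_insert_top[of 0 "{0}" 1]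
  by (auto simp: even_gap_sets_def alternating_def)

lemma even_gap_sets_1: "even_gap_sets (Suc 0) = {{1}}"
proof -
  have "alternating {0}" by (simp add: alternating_def)
  then have "\<not> alternating {2, 0}" "alternating {1, 0}"
    using alternating_insert_top[of 0 "{0}" 2] alternating_insert_top[of 0 "{0}" 1] by auto
  moreover from this have "alternating {2, 1, 0}"
    by (subst alternating_insert_top[where m = 1]) auto
  then have "alternating {2, 0, 1}" by (simp add: insert_commute)
  ultimately show ?thesis by (auto simp: even_gap_sets_def subset_singleton_iff)
qed

text \<open>If \<open>n + 2\<close> belongs to \<open>X\<close>, it takes over as upper sentinel for
  the rest, its own distance to \<open>n + 3\<close> being 1. Otherwise the top gap is nonempty and
  even, so \<open>n + 1\<close> is missing too and the sentinel drops by two. Reading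
  \<open>X\<close> as the uncovered vertices of a matching, these are the cases of the last vertex
  being uncovered or covered.\<close>

lemma even_gap_sets_Suc_Suc:
  "even_gap_sets (Suc (Suc n)) =
    even_gap_sets n \<union> insert (int n + 2) ` even_gap_sets (Suc n)" (is "?L = ?A \<union> ?B")
proof (rule set_eqI)
  fix X :: "int set"
  \<comment> \<open>Including 0 keeps the maximum meaningful for empty \<open>X\<close>; it is then
    the lower sentinel itself.\<close>
  define m where "m = Max (insert 0 X)"
  have top: "alternating (insert b (insert 0 X)) \<longleftrightarrow> alternating (insert 0 X) \<and> odd (b - m)"
    if "finite X" "m < b" for b
    using that unfolding m_def
    by (intro alternating_insert_top Max_in Max_ge) auto
  show "X \<in> ?L \<longleftrightarrow> X \<in> ?A \<union> ?B"
  proof (cases "int n + 2 \<in> X")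
    case True
    define X' where "X' = X - {int n + 2}"
    have X: "X = insert (int n + 2) X'" "int n + 2 \<notin> X'" using True by (auto simp: X'_def)
    have "X \<in> ?L \<longleftrightarrow> X' \<subseteq> {1..int n + 1} \<and>
      alternating (insert (int n + 3) (insert (int n + 2) (insert 0 X')))"
    proof -
      have "X \<subseteq> {1..int n + 2} \<longleftrightarrow> X' \<subseteq> {1..int n + 1}"
      proof -
        have "{1..int n + 2} = insert (int n + 2) {1..int n + 1}" by auto
        then show ?thesis using X by (simp add: subset_insert)
      qed
      moreover have "insert 0 X = insert (int n + 2) (insert 0 X')" using X by auto
      ultimately show ?thesis by (simp add: even_gap_sets_def add_ac)
    qed
    also have "\<dots> \<longleftrightarrow> X' \<subseteq> {1..int n + 1} \<and> alternating (insert (int n + 2) (insert 0 X'))"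
      by (rule conj_cong[OF refl], subst alternating_insert_top[where m = "int n + 2"]) auto
    also have "\<dots> \<longleftrightarrow> X' \<in> even_gap_sets (Suc n)"
      by (simp add: even_gap_sets_def add_ac)
    also have "\<dots> \<longleftrightarrow> X \<in> ?B"
    proof
      assume "X \<in> ?B"
      then obtain X'' where "X = insert (int n + 2) X''" "X'' \<in> even_gap_sets (Suc n)" by auto
      moreover then have "int n + 2 \<notin> X''" by (auto simp: even_gap_sets_def)
      ultimately show "X' \<in> even_gap_sets (Suc n)" by (simp add: X'_def)
    qed (use X in blast)
    finally have "X \<in> ?L \<longleftrightarrow> X \<in> ?B" .
    moreover have "X \<notin> ?A" using True by (auto simp: even_gap_sets_def)
    ultimately show ?thesis by blast
  next
    case False
    have fin: "finite X" if "X \<subseteq> {1..int k}" for k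
      by (rule finite_subset[OF that]) simp
    have m: "m \<in> insert 0 X" "\<And>x. x \<in> X \<Longrightarrow> x \<le> m" if "finite X"
      unfolding m_def using that by (rule Max_in[OF finite.insertI], simp) (simp add: that)
    have "X \<notin> ?B" using False by auto
    moreover have "X \<in> ?L \<longleftrightarrow> X \<in> ?A"
    proof
      assume L: "X \<in> ?L"
      then have sub: "X \<subseteq> {1..int n + 2}" and f: "finite X"
        using fin[of "Suc (Suc n)"] by (auto simp: even_gap_sets_def)
      then have sub: "X \<subseteq> {1..int n + 1}" using False by (force simp: le_less)
      then have "m \<le> int n + 1" using m(1)[OF f] by auto
      then have alt: "alternating (insert 0 X)" "odd (int n + 3 - m)"
        using L top[OF f, of "int n + 3"] by (auto simp: even_gap_sets_def add_ac)
      then have "m \<noteq> int n + 1" by auto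
      then have mn: "m \<le> int n" using \<open>m \<le> int n + 1\<close> by simp
      then have "X \<subseteq> {1..int n}" using m(2)[OF f] sub by force
      moreover have "alternating (insert (int n + 1) (insert 0 X))"
        using top[OF f, of "int n + 1"] mn alt by auto
      ultimately show "X \<in> ?A" by (simp add: even_gap_sets_def)
    next
      assume A: "X \<in> ?A"
      then have sub: "X \<subseteq> {1..int n}" and f: "finite X"
        using fin[of n] by (auto simp: even_gap_sets_def)
      then have "m \<le> int n" using m(1)[OF f] by auto
      then have "alternating (insert (int n + 3) (insert 0 X))"
        using A top[OF f, of "int n + 1"] top[OF f, of "int n + 3"]
        by (auto simp: even_gap_sets_def)
      then show "X \<in> ?L" using sub by (auto simp: even_gap_sets_def add_ac)
    qed
    ultimately show ?thesis by blast
  qed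
qed

lemma finite_even_gap_sets [simp]: "finite (even_gap_sets n)"
  by (rule finite_subset[of _ "Pow {1..int n}"]) (auto simp: even_gap_sets_def)

lemma card_even_gap_sets_Suc_Suc:
  "card (even_gap_sets (Suc (Suc n))) = card (even_gap_sets n) + card (even_gap_sets (Suc n))"
proof -
  have "inj_on (insert (int n + 2)) (even_gap_sets (Suc n))"
    by (intro inj_onI, drule insert_ident[THEN iffD1, rotated 2]) (auto simp: even_gap_sets_def)
  moreover have "even_gap_sets n \<inter> insert (int n + 2) ` even_gap_sets (Suc n) = {}"
    by (auto simp: even_gap_sets_def)
  ultimately show ?thesis
    by (simp add: even_gap_sets_Suc_Suc card_Un_disjoint card_image)
qed

lemma edges_path_Suc_Suc:
  "edges (path_graph (Suc (Suc n))) = insert {Suc n, Suc (Suc n)} (edges (path_graph (Suc n)))"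
  by (auto simp: path_graph_def less_Suc_eq)

lemma edges_path_Suc_avoiding:
  "e \<in> edges (path_graph (Suc n)) \<Longrightarrow> Suc n \<notin> e \<Longrightarrow> e \<in> edges (path_graph n)"
  by (auto simp: path_graph_def less_Suc_eq)

lemma edge_path_subset: "e \<in> edges (path_graph n) \<Longrightarrow> e \<subseteq> {1..n}"
  by (auto simp: path_graph_def)

text \<open>Only the last edge reaches the last vertex; if it is used, it also blocks its other
  endpoint, and the remaining edges lie in the first \<open>n\<close> vertices.\<close>

lemma matchings_path_Suc_Suc:
  "{M. matching (path_graph (Suc (Suc n))) M} =
    {M. matching (path_graph (Suc n)) M} \<union>
    insert {Suc n, Suc (Suc n)} ` {M. matching (path_graph n) M}" (is "?L = ?A \<union> insert ?e ` ?B")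
proof (intro equalityI subsetI)
  fix M assume "M \<in> ?L"
  then have sub: "M \<subseteq> insert ?e (edges (path_graph (Suc n)))"
    and dis: "\<And>e f. \<lbrakk>e \<in> M; f \<in> M; e \<noteq> f\<rbrakk> \<Longrightarrow> e \<inter> f = {}"
    by (auto simp: matching_def edges_path_Suc_Suc)
  show "M \<in> ?A \<union> insert ?e ` ?B"
  proof (cases "?e \<in> M")
    case True
    have "M - {?e} \<subseteq> edges (path_graph n)"
    proof
      fix f assume f: "f \<in> M - {?e}"
      then have "Suc n \<notin> f" using dis[OF _ True, of f] by auto
      then show "f \<in> edges (path_graph n)" using f sub edges_path_Suc_avoiding by blast
    qed
    then have "M - {?e} \<in> ?B" using dis by (auto simp: matching_def)
    moreover have "M = insert ?e (M - {?e})" using True by auto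
    ultimately show ?thesis by blast
  next
    case False
    then show ?thesis using sub dis by (auto simp: matching_def)
  qed
next
  fix M assume "M \<in> ?A \<union> insert ?e ` ?B"
  then consider "M \<in> ?A" | M' where "M' \<in> ?B" "M = insert ?e M'" by blast
  then show "M \<in> ?L"
  proof cases
    case 1
    then show ?thesis by (auto simp: matching_def edges_path_Suc_Suc)
  next
    case 2
    have "edges (path_graph n) \<subseteq> edges (path_graph (Suc (Suc n)))"
      by (auto simp: path_graph_def)
    moreover have "f \<inter> ?e = {}" if "f \<in> M'" for f
    proof -
      have "f \<in> edges (path_graph n)" using that 2 by (auto simp: matching_def)
      from edge_path_subset[OF this] show ?thesis by auto
    qed
    ultimately show ?thesis
      using 2 by (auto simp: matching_def edges_path_Suc_Suc Int_commute)
  qed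
qed

lemma finite_matchings_path [simp]: "finite {M. matching (path_graph n) M}"
proof (rule finite_subset)
  show "{M. matching (path_graph n) M} \<subseteq> Pow (Pow {1..n})"
    using edge_path_subset by (fastforce simp: matching_def)
qed simp

lemma num_matchings_path_Suc_Suc:
  "num_matchings (path_graph (Suc (Suc n))) =
    num_matchings (path_graph n) + num_matchings (path_graph (Suc n))"
proof -
  let ?e = "{Suc n, Suc (Suc n)}"
  have out: "?e \<notin> M" if "matching (path_graph k) M" "k \<le> Suc n" for M k
    using that edge_path_subset[of ?e k] by (auto simp: matching_def)
  have "inj_on (insert ?e) {M. matching (path_graph n) M}"
    using out[of n] by (intro inj_onI) (auto dest!: insert_ident[THEN iffD1, rotated 2])
  moreover have "{M. matching (path_graph (Suc n)) M} \<inter> insert ?e ` {M. matching (path_graph n) M} = {}"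
    using out[of "Suc n"] by auto
  ultimately show ?thesis
    unfolding num_matchings_def matchings_path_Suc_Suc
    by (simp add: card_Un_disjoint card_image)
qed

text \<open>The vertices missed by a matching of a path leave gaps of even length, each of which the
  matching tiles in the only possible way.\<close>

lemma card_even_gap_sets: "card (even_gap_sets n) = num_matchings (path_graph n)"
proof (induction n rule: induct_nat_012)
  case 0
  have "{M. matching (path_graph 0) M} = {{}}" by (auto simp: matching_def path_graph_def)
  then show ?case by (simp add: even_gap_sets_0 num_matchings_def)
next
  case 1
  have "{M. matching (path_graph (Suc 0)) M} = {{}}" by (auto simp: matching_def path_graph_def)
  then show ?case by (simp add: even_gap_sets_1 num_matchings_def)
next
  case (ge2 n)
  then show ?case by (simp add: card_even_gap_sets_Suc_Suc num_matchings_path_Suc_Suc)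
qed

section \<open>Counting on arbitrary integer intervals and on disjoint blocks\<close>

lemma alternating_translate: "alternating ((+) c ` Y) \<longleftrightarrow> alternating Y"
proof -
  have "(+) c ` Y \<inter> {c + p<..<c + q} = {} \<longleftrightarrow> Y \<inter> {p<..<q} = {}" for p q
    by auto
  then show ?thesis by (auto simp: alternating_def)
qed

lemma card_alternating_between:
  "card {X. X \<subseteq> {l<..<l + int n + 1} \<and> alternating (insert (l + int n + 1) (insert l X))} =
     num_matchings (path_graph n)" (is "card ?S = _")
proof -
  have "?S = image ((+) l) ` even_gap_sets n"
  proof (rule set_eqI)
    fix X
    have X: "X = (+) l ` (+) (- l) ` X" by (simp add: image_comp o_def)
    have "X \<in> ?S \<longleftrightarrow> (+) (- l) ` X \<in> even_gap_sets n"
      using alternating_translate[of "- l" "insert (l + int n + 1) (insert l X)"]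
      by (auto simp: even_gap_sets_def subset_iff add_ac)
    also have "\<dots> \<longleftrightarrow> X \<in> image ((+) l) ` even_gap_sets n"
    proof
      assume "X \<in> image ((+) l) ` even_gap_sets n"
      then show "(+) (- l) ` X \<in> even_gap_sets n" by (auto simp: image_comp o_def)
    qed (use X in blast)
    finally show "X \<in> ?S \<longleftrightarrow> X \<in> image ((+) l) ` even_gap_sets n" .
  qed
  moreover have "inj_on (image ((+) l)) (even_gap_sets n)"
    by (simp add: inj_on_def inj_image_eq_iff)
  ultimately show ?thesis by (simp add: card_image card_even_gap_sets)
qed

text \<open>Conditions on disjoint blocks are independent: a set is the union of its traces on the
  blocks, and the traces can be chosen freely, so the sets correspond to a dependent
  product.\<close>

lemma card_blockwise_subsets:
  assumes "finite I" "disjoint_family_on A I" "\<And>i. i \<in> I \<Longrightarrow> finite (A i)"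
  shows "card {Z. Z \<subseteq> (\<Union>i\<in>I. A i) \<and> (\<forall>i\<in>I. P i (Z \<inter> A i))} =
    (\<Prod>i\<in>I. card {X. X \<subseteq> A i \<and> P i X})"
proof -
  let ?S = "{Z. Z \<subseteq> (\<Union>i\<in>I. A i) \<and> (\<forall>i\<in>I. P i (Z \<inter> A i))}"
  let ?T = "PiE I (\<lambda>i. {X. X \<subseteq> A i \<and> P i X})"
  have block: "(\<Union>j\<in>I. g j) \<inter> A i = g i" if "i \<in> I" "\<And>j. j \<in> I \<Longrightarrow> g j \<subseteq> A j" for g i
  proof -
    have "g j \<inter> A i = {}" if "j \<in> I" "j \<noteq> i" for j
      using assms(2) that \<open>i \<in> I\<close> \<open>\<And>j. j \<in> I \<Longrightarrow> g j \<subseteq> A j\<close>[of j]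
      unfolding disjoint_family_on_def by blast
    then show ?thesis using that by blast
  qed
  have "bij_betw (\<lambda>Z. \<lambda>i\<in>I. Z \<inter> A i) ?S ?T"
  proof (rule bij_betw_byWitness[where f' = "\<lambda>g. \<Union>i\<in>I. g i"])
    show "\<forall>Z\<in>?S. (\<Union>i\<in>I. (\<lambda>i\<in>I. Z \<inter> A i) i) = Z" by auto
    show "\<forall>g\<in>?T. (\<lambda>i\<in>I. (\<Union>i\<in>I. g i) \<inter> A i) = g"
    proof
      fix g assume g: "g \<in> ?T"
      then have "\<And>j. j \<in> I \<Longrightarrow> g j \<subseteq> A j" by (auto simp: PiE_iff)
      then show "(\<lambda>i\<in>I. (\<Union>i\<in>I. g i) \<inter> A i) = g"
        using g by (intro extensionalityI[of _ I]) (auto simp: block PiE_iff)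
    qed
    show "(\<lambda>Z. \<lambda>i\<in>I. Z \<inter> A i) ` ?S \<subseteq> ?T" by auto
    show "(\<lambda>g. \<Union>i\<in>I. g i) ` ?T \<subseteq> ?S"
    proof (intro image_subsetI CollectI conjI ballI)
      fix g assume g: "g \<in> ?T"
      then have sub: "\<And>j. j \<in> I \<Longrightarrow> g j \<subseteq> A j" by (auto simp: PiE_iff)
      then show "(\<Union>i\<in>I. g i) \<subseteq> (\<Union>i\<in>I. A i)" by blast
      show "P i ((\<Union>i\<in>I. g i) \<inter> A i)" if "i \<in> I" for i
        using block[OF that sub] g that by (auto simp: PiE_iff)
    qed
  qed
  then show ?thesis using assms(1) by (simp add: bij_betw_same_card card_PiE)
qed

section \<open>Rooted forests as alternating markings\<close>

lemma adjacent_sym: "adjacent G u v \<Longrightarrow> adjacent G v u"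
  by (simp add: adjacent_def insert_commute)

lemma reach_sym: "(adjacent G)\<^sup>*\<^sup>* u v \<Longrightarrow> (adjacent G)\<^sup>*\<^sup>* v u"
  by (induction rule: rtranclp_induct) (auto intro: adjacent_sym converse_rtranclp_into_rtranclp)

text \<open>Separates "exactly one root" into its two halves: uniqueness is what consecutive odd
  marks endanger, existence is what consecutive even marks destroy.\<close>

lemma unique_root_iff:
  assumes "S \<subseteq> verts F"
  shows "(\<forall>C\<in>components F. \<exists>!s. s \<in> S \<and> s \<in> C) \<longleftrightarrow>
    (\<forall>s\<in>S. \<forall>t\<in>S. (adjacent F)\<^sup>*\<^sup>* s t \<longrightarrow> s = t) \<and>
    (\<forall>v\<in>verts F. \<exists>s\<in>S. (adjacent F)\<^sup>*\<^sup>* v s)" (is "?L \<longleftrightarrow> ?U \<and> ?E")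
proof (intro iffI conjI)
  assume L: ?L
  show ?U
  proof (intro ballI impI)
    fix s t assume "s \<in> S" "t \<in> S" "(adjacent F)\<^sup>*\<^sup>* s t"
    moreover then have "s \<in> component_of F s" "t \<in> component_of F s"
      using assms by (auto simp: component_of_def)
    moreover have "component_of F s \<in> components F"
      using \<open>s \<in> S\<close> assms by (auto simp: components_def)
    ultimately show "s = t" using L by blast
  qed
  show ?E
    using L by (fastforce simp: components_def component_of_def)
next
  assume UE: "?U \<and> ?E"
  show ?L
  proof
    fix C assume "C \<in> components F"
    then obtain v where v: "v \<in> verts F" "C = component_of F v"
      by (auto simp: components_def)
    then obtain s where s: "s \<in> S" "(adjacent F)\<^sup>*\<^sup>* v s" using UE by blast
    show "\<exists>!s. s \<in> S \<and> s \<in> C"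
    proof (rule ex1I[of _ s])
      show "s \<in> S \<and> s \<in> C" using s v assms by (auto simp: component_of_def)
      fix t assume "t \<in> S \<and> t \<in> C"
      then have "t \<in> S" "(adjacent F)\<^sup>*\<^sup>* t s"
        using v s by (auto simp: component_of_def intro: reach_sym rtranclp_trans)
      then show "t = s" using UE s by blast
    qed
  qed
qed

text \<open>A cycle would contain a vertex of maximal height, with two distinct lower neighbours.\<close>

lemma acyclic_graph_if_height:
  fixes h :: "'a \<Rightarrow> nat"
  assumes neq: "\<And>u v. adjacent G u v \<Longrightarrow> h u \<noteq> h v"
    and unique: "\<And>u v w. \<lbrakk>adjacent G u v; adjacent G u w; h v < h u; h w < h u\<rbrakk> \<Longrightarrow> v = w"
  shows "acyclic_graph G"
  unfolding acyclic_graph_def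
proof
  assume "\<exists>vs. is_cycle G vs"
  then obtain vs where len: "length vs \<ge> 3" and dist: "distinct vs"
    and adj: "\<And>i. i < length vs \<Longrightarrow> adjacent G (vs ! i) (vs ! (Suc i mod length vs))"
    by (auto simp: is_cycle_def)
  let ?n = "length vs"
  obtain i where i: "i < ?n" and max: "\<And>j. j < ?n \<Longrightarrow> h (vs ! j) \<le> h (vs ! i)"
  proof -
    have "finite ((\<lambda>j. h (vs ! j)) ` {..<?n})" "(\<lambda>j. h (vs ! j)) ` {..<?n} \<noteq> {}"
      using len by (auto simp: lessThan_empty_iff)
    from Max_in[OF this] Max_ge[OF this(1)] show ?thesis
      by (smt (verit) imageE image_eqI lessThan_iff that)
  qed
  \<comment> \<open>The two cyclic neighbours of a highest vertex; they are distinct because the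
    cycle has at least three vertices, and strictly lower by maximality and
    \<open>neq\<close>.\<close>
  define a where "a = Suc i mod ?n"
  define b where "b = (if i = 0 then ?n - 1 else i - 1)"
  have b: "b < ?n" "Suc b mod ?n = i" and a: "a < ?n" and "a \<noteq> b"
    using i len by (auto simp: a_def b_def mod_Suc split: if_splits)
  have "adjacent G (vs ! i) (vs ! a)" "adjacent G (vs ! i) (vs ! b)"
    using adj[OF i] adj[OF b(1)] b by (auto simp: a_def intro: adjacent_sym)
  then have "vs ! a = vs ! b"
    using max[OF a] max[OF b(1)] neq unique by (metis le_neq_implies_less)
  then show False using dist a b(1) \<open>a \<noteq> b\<close> by (simp add: nth_eq_iff_index_eq)
qed

section \<open>From forests to alternating markings\<close>

locale rooted_wheel =
  fixes N :: nat and R :: "wheel_vertex set"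
  assumes N_ge_3: "N \<ge> 3" and R_subset: "R \<subseteq> rim_vertices N" and R_nonempty: "R \<noteq> {}"
begin

abbreviation "rim \<equiv> rim_at N"
abbreviation "W \<equiv> wheel_graph N"
abbreviation "V \<equiv> verts (wheel_graph N)"

lemma N_ge_1: "N \<ge> 1"
  using N_ge_3 by simp

lemmas rim_eq_iff = rim_at_eq_iff[OF N_ge_1]

lemma V_eq: "V = insert Center (range rim)"
  by (simp add: wheel_graph_def range_rim_at[OF N_ge_1])

lemma rim_add_N [simp]: "rim (k + int N) = rim k"
  by (simp add: rim_eq_iff)

lemma root_at: obtains k where "rim k \<in> R"
proof -
  have "R \<subseteq> range rim" using R_subset range_rim_at[OF N_ge_1] by simp
  then show ?thesis using R_nonempty that by blast
qed

lemma root_in_window: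
  obtains j where "i < j" "j \<le> i + int N" "rim j \<in> R"
proof -
  obtain k where k: "rim k \<in> R" by (rule root_at)
  \<comment> \<open>The representative of \<open>k\<close> modulo \<open>N\<close> among
    \<open>i + 1, ..., i + N\<close>.\<close>
  define j where "j = i + 1 + (k - i - 1) mod int N"
  have "i < j" "j \<le> i + int N"
    using N_ge_1 pos_mod_bound[of "int N" "k - i - 1"] pos_mod_sign[of "int N" "k - i - 1"]
    unfolding j_def by linarith+
  moreover have "int N dvd j - k"
  proof -
    have "j - k = - (int N * ((k - i - 1) div int N))"
      using mult_div_mod_eq[of "int N" "k - i - 1"] unfolding j_def by linarith
    then show ?thesis by simp
  qed
  then have "rim j = rim k" by (simp add: rim_eq_iff)
  ultimately show ?thesis using that k by simp
qed

lemma rim_inj_window: "\<lbrakk>rim k = rim l; k < l + int N; l < k + int N\<rbrakk> \<Longrightarrow> k = l"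
  using zdvd_imp_le[of "int N" "k - l"] zdvd_imp_le[of "int N" "l - k"]
  by (cases k l rule: linorder_cases) (auto simp: rim_eq_iff dvd_diff_commute)

lemma neighbour_cases:
  assumes "D \<subseteq> edges W" "{rim k, v} \<in> D"
  obtains "v = Center" | "v = rim (k + 1)" | "v = rim (k - 1)"
proof -
  obtain p where p: "{rim k, v} = slot N p"
    using assms edges_wheel_eq_range_slot[OF N_ge_1] by auto
  have shift: "rim k = rim l \<Longrightarrow> rim (k + d) = rim (l + d)" for k l d
    by (simp add: rim_eq_iff)
  show ?thesis
  proof (cases p rule: slot_cases)
    case (1 l)
    then have "(rim k = rim l \<and> v = rim (l + 1)) \<or> (rim k = rim (l + 1) \<and> v = rim l)"
      using p by (auto simp: slot_even doubleton_eq_iff)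
    then show ?thesis
      using that shift[of k l 1] shift[of k "l + 1" "-1"] by auto
  next
    case (2 l)
    then show ?thesis using p that by (auto simp: slot_odd doubleton_eq_iff)
  qed
qed

lemma reach_along_rim:
  assumes "i \<le> j" and "\<And>k. i \<le> k \<Longrightarrow> k < j \<Longrightarrow> 2 * k \<notin> marks N R D"
  shows "(adjacent (V, D))\<^sup>*\<^sup>* (rim i) (rim j)"
  using assms
proof (induction j rule: int_ge_induct)
  case (step j)
  have "adjacent (V, D) (rim j) (rim (j + 1))"
    using step.prems[of j] step.hyps by (simp add: mem_marks_even adjacent_def)
  moreover have "(adjacent (V, D))\<^sup>*\<^sup>* (rim i) (rim j)"
    using step by simp
  ultimately show ?case by (rule rtranclp.rtrancl_into_rtrancl[rotated])
qed simp

lemma rooted_spanning_forest_iff: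
  "rooted_spanning_forest W ({Center} \<union> R) F \<longleftrightarrow>
    (\<exists>D. F = (V, D) \<and> D \<subseteq> edges W \<and> acyclic_graph F \<and>
      (\<forall>s\<in>{Center} \<union> R. \<forall>t\<in>{Center} \<union> R. (adjacent F)\<^sup>*\<^sup>* s t \<longrightarrow> s = t) \<and>
      (\<forall>v\<in>V. \<exists>s\<in>{Center} \<union> R. (adjacent F)\<^sup>*\<^sup>* v s))"
proof -
  obtain U D where F: "F = (U, D)" by (cases F)
  have "simple_graph (V, D)" if "D \<subseteq> edges W"
    using simple_graph_wheel[OF N_ge_3] that by (auto simp: simple_graph_def)
  then have sub: "subgraph F W \<and> verts F = V \<longleftrightarrow> U = V \<and> D \<subseteq> edges W"
    by (auto simp: F subgraph_def)
  have "{Center} \<union> R \<subseteq> V"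
    using R_subset by (auto simp: wheel_graph_def)
  then have "U = V \<Longrightarrow> {Center} \<union> R \<subseteq> verts F" by (simp add: F)
  note roots = unique_root_iff[OF this]
  show ?thesis
  proof (cases "U = V \<and> D \<subseteq> edges W")
    case True
    then have "rooted_spanning_forest W ({Center} \<union> R) F \<longleftrightarrow> acyclic_graph F \<and>
      (\<forall>C\<in>components F. \<exists>!s. s \<in> {Center} \<union> R \<and> s \<in> C)"
      using sub by (simp add: rooted_spanning_forest_def spanning_forest_def)
    then show ?thesis using roots True F by auto
  next
    case False
    then show ?thesis
      using sub by (auto simp: F rooted_spanning_forest_def spanning_forest_def)
  qed
qed

text \<open>Spokes at roots must be excluded separately: such a position is marked whether or not
  its spoke is in \<open>D\<close>, so \<open>marks\<close> cannot detect it.\<close>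

definition admissible :: "wheel_vertex set set \<Rightarrow> bool" where
  "admissible D \<longleftrightarrow> D \<subseteq> edges W \<and> (\<forall>k. rim k \<in> R \<longrightarrow> {Center, rim k} \<notin> D) \<and>
     alternating (marks N R D)"

lemma admissible_if_forest:
  assumes sub: "D \<subseteq> edges W" and acyc: "acyclic_graph (V, D)"
    and uniq: "\<And>s t. \<lbrakk>s \<in> {Center} \<union> R; t \<in> {Center} \<union> R; (adjacent (V, D))\<^sup>*\<^sup>* s t\<rbrakk> \<Longrightarrow> s = t"
    and ex: "\<And>v. v \<in> V \<Longrightarrow> \<exists>s\<in>{Center} \<union> R. (adjacent (V, D))\<^sup>*\<^sup>* v s"
  shows "admissible D"
proof -
  let ?adj = "adjacent (V, D)" and ?Y = "marks N R D"
  have noroot: "{Center, rim k} \<notin> D" if "rim k \<in> R" for k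
  proof
    assume "{Center, rim k} \<in> D"
    then have "?adj\<^sup>*\<^sup>* Center (rim k)" by (simp add: adjacent_def r_into_rtranclp)
    then show False using uniq[of Center "rim k"] that by simp
  qed
  have odd_odd: False
    if ij: "i < j" "2 * i - 1 \<in> ?Y" "2 * j - 1 \<in> ?Y" "?Y \<inter> {2 * i - 1<..<2 * j - 1} = {}" for i j
  proof -
    have gap: "x \<notin> ?Y" if "2 * i - 1 < x" "x < 2 * j - 1" for x
      using ij(4) that by auto
    have rim_free: "2 * k \<notin> ?Y" if "i \<le> k" "k < j" for k
      using that by (intro gap) auto
    have no_root_between: "rim k \<notin> R" if "i < k" "k < j" for k
      using gap[of "2 * k - 1"] that by (auto simp: mem_marks_odd)
    have path: "?adj\<^sup>*\<^sup>* (rim i) (rim j)"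
      by (rule reach_along_rim) (use ij rim_free in auto)
    have adj_succ: "?adj (rim k) (rim (k + 1))" if "i \<le> k" "k < j" for k
      using rim_free[OF that] by (simp add: mem_marks_even adjacent_def)
    \<comment> \<open>Some root occurs within one turn after \<open>i\<close> and none lies strictly
      between \<open>i\<close> and \<open>j\<close>, so the arc is at most one turn long.\<close>
    obtain k where k: "i < k" "k \<le> i + int N" "rim k \<in> R" by (rule root_in_window)
    then have "j \<le> i + int N" using no_root_between[of k] by linarith
    \<comment> \<open>A marked spoke leads either to its own rim vertex, if that is a root, or along
      the spoke to \<open>Center\<close>. Comparing both ends of the arc decides which cycle
      appears.\<close>
    have root_end: "\<exists>s\<in>{Center} \<union> R. ?adj\<^sup>*\<^sup>* (rim k) s \<and> (rim k \<in> R \<longrightarrow> s = rim k) \<and> (rim k \<notin> R \<longrightarrow> s = Center)"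
      if "2 * k - 1 \<in> ?Y" for k
      using that
      by (auto simp: mem_marks_odd adjacent_def insert_commute intro!: r_into_rtranclp)
    obtain s t where st: "s \<in> {Center} \<union> R" "t \<in> {Center} \<union> R" "?adj\<^sup>*\<^sup>* (rim i) s" "?adj\<^sup>*\<^sup>* (rim j) t"
       "rim i \<in> R \<longrightarrow> s = rim i" "rim i \<notin> R \<longrightarrow> s = Center"
       "rim j \<in> R \<longrightarrow> t = rim j" "rim j \<notin> R \<longrightarrow> t = Center"
      using root_end ij by metis
    have "?adj\<^sup>*\<^sup>* s t"
      using st path by (meson reach_sym rtranclp_trans)
    then have "s = t" using uniq st by blast
    show False
    proof (cases "rim i \<in> R")
      case True
      then have "rim i = rim j" using st \<open>s = t\<close> by (cases "rim j \<in> R") auto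
      then have j: "j = i + int N"
        using rim_inj_window[of i j] ij \<open>j \<le> i + int N\<close> by force
      \<comment> \<open>The two ends are the same root, one turn apart, so the cycle is the whole
        rim and avoids \<open>Center\<close>.\<close>
      let ?vs = "map (\<lambda>n. rim (i + int n)) [0..<N]"
      have "is_cycle (V, D) ?vs"
        unfolding is_cycle_def
      proof (intro conjI allI impI)
        show "3 \<le> length ?vs" using N_ge_3 by simp
        show "distinct ?vs"
          by (auto simp: distinct_map inj_on_def dest!: rim_inj_window)
        fix n assume "n < length ?vs"
        moreover have "rim (i + int n + 1) = rim i" if "Suc n = N"
        proof -
          have "i + int n + 1 = i + int N" using that by simp
          then show ?thesis by (simp only: rim_add_N)
        qed
        ultimately have "?vs ! (Suc n mod length ?vs) = rim (i + int n + 1)" "?vs ! n = rim (i + int n)"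
          by (auto simp: mod_Suc add_ac)
        then show "?adj (?vs ! n) (?vs ! (Suc n mod length ?vs))"
          using adj_succ[of "i + int n"] j \<open>n < length ?vs\<close> by simp
      qed
      then show False using acyc by (auto simp: acyclic_graph_def)
    next
      case False
      then have nR: "rim i \<notin> R" "rim j \<notin> R"
        using st \<open>s = t\<close> by auto
      then have "j < i + int N"
        using k no_root_between[of k] \<open>j \<le> i + int N\<close> by (metis linorder_neqE rim_add_N order_le_less le_less_trans)
      have spokes: "?adj Center (rim i)" "?adj (rim j) Center"
        using nR ij by (auto simp: mem_marks_odd adjacent_def insert_commute)
      \<comment> \<open>Both ends now carry spokes of \<open>D\<close>, and the arc closes through
        \<open>Center\<close>; since \<open>i < j\<close>, the list has at least three
        vertices.\<close>
      define m where "m = nat (j - i)"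
      let ?ws = "map (\<lambda>n. rim (i + int n)) [0..<Suc m]"
      let ?vs = "Center # ?ws"
      have "is_cycle (V, D) ?vs"
        unfolding is_cycle_def
      proof (intro conjI allI impI)
        show "3 \<le> length ?vs" using ij by (simp add: m_def)
        have "inj_on (\<lambda>n. rim (i + int n)) {0..<Suc m}"
          using \<open>j < i + int N\<close> by (auto simp: inj_on_def m_def dest!: rim_inj_window)
        then show "distinct ?vs"
          by (auto simp: distinct_map simp del: upt_Suc)
        fix n assume n: "n < length ?vs"
        have nth: "?vs ! Suc l = rim (i + int l)" if "l \<le> m" for l
          using that by (simp del: upt_Suc)
        consider "n = 0" | l where "n = Suc l" "l < m" | "n = Suc m"
          using n by (cases n) (auto simp: less_Suc_eq)
        then show "?adj (?vs ! n) (?vs ! (Suc n mod length ?vs))"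
        proof cases
          case 1
          then show ?thesis using spokes nth[of 0] by simp
        next
          case (2 l)
          then show ?thesis
            using adj_succ[of "i + int l"] nth[of l] nth[of "Suc l"]
            by (simp add: m_def add_ac del: upt_Suc)
        next
          case 3
          then show ?thesis using spokes nth[of m] ij by (simp add: m_def del: upt_Suc)
        qed
      qed
      then show False using acyc by (auto simp: acyclic_graph_def)
    qed
  qed
  have even_even: False
    if ij: "i < j" "2 * i \<in> ?Y" "2 * j \<in> ?Y" "?Y \<inter> {2 * i<..<2 * j} = {}" for i j
  proof -
    \<comment> \<open>The arc between two missing rim edges: without roots or spokes it is closed
      under adjacency, so none of its vertices reaches a root.\<close>
    define A where "A = rim ` {i<..j}"
    have bare: "{Center, rim k} \<notin> D \<and> rim k \<notin> R" if "i < k" "k \<le> j" for k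
    proof -
      have "2 * k - 1 \<notin> ?Y" using ij(4) that by auto
      then show ?thesis by (simp add: mem_marks_odd)
    qed
    have closed: "v \<in> A" if "?adj u v" "u \<in> A" for u v
    proof -
      obtain k where k: "u = rim k" "i < k" "k \<le> j" using \<open>u \<in> A\<close> by (auto simp: A_def)
      have e: "{rim k, v} \<in> D" using that k by (simp add: adjacent_def)
      show ?thesis
      proof (rule neighbour_cases[OF sub e])
        assume "v = Center"
        then show ?thesis using bare k e by (auto simp: insert_commute)
      next
        assume v: "v = rim (k + 1)"
        then have "k \<noteq> j" using ij(3) e by (auto simp: mem_marks_even)
        then show ?thesis using v k by (auto simp: A_def)
      next
        assume v: "v = rim (k - 1)"
        then have "k - 1 \<noteq> i" using ij(2) e by (auto simp: mem_marks_even insert_commute)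
        then show ?thesis using v k by (auto simp: A_def)
      qed
    qed
    obtain s where s: "s \<in> {Center} \<union> R" "?adj\<^sup>*\<^sup>* (rim j) s"
      using ex[of "rim j"] by (auto simp: V_eq)
    from s(2) have "s \<in> A"
      by (induction rule: rtranclp_induct) (use ij closed in \<open>auto simp: A_def\<close>)
    then show False using bare s(1) by (auto simp: A_def)
  qed
  have "alternating ?Y"
    unfolding alternating_def
  proof (intro ballI impI)
    fix p q assume "p \<in> ?Y" "q \<in> ?Y" "p < q \<and> ?Y \<inter> {p<..<q} = {}"
    then show "odd (q - p)"
      using odd_odd even_even by (cases p rule: slot_cases; cases q rule: slot_cases) auto
  qed
  then show ?thesis using sub noroot by (simp add: admissible_def)
qed

end

section \<open>From alternating markings back to forests: attachment points\<close>

text \<open>\<open>t\<close> is the attachment point of the rim arc containing \<open>k\<close>.\<close>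

definition nearest :: "int set \<Rightarrow> int \<Rightarrow> int \<Rightarrow> bool" where
  "nearest Y k t \<longleftrightarrow> 2 * t - 1 \<in> Y \<and>
     (\<forall>x\<in>Y. \<not> (2 * t - 1 < x \<and> x \<le> 2 * k - 1) \<and> \<not> (2 * k - 1 \<le> x \<and> x < 2 * t - 1))"

text \<open>Two different candidates would be consecutive odd marks, since every mark between them
  is excluded by one or the other depending on its side of \<open>2 * k - 1\<close>.\<close>

lemma nearest_unique:
  assumes "alternating Y" "nearest Y k s" "nearest Y k t"
  shows "s = t"
proof -
  have "\<not> s < t" if st: "nearest Y k s" "nearest Y k t" for s t
  proof
    assume "s < t"
    have "\<not> (2 * s - 1 < x \<and> x < 2 * t - 1)" if "x \<in> Y" for x
      using st that unfolding nearest_def by (cases "x \<le> 2 * k - 1") auto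
    then have "odd ((2 * t - 1) - (2 * s - 1))"
      using \<open>s < t\<close> st by (intro alternatingD[OF assms(1)]) (auto simp: nearest_def)
    then show False by simp
  qed
  then show ?thesis using assms by (meson linorder_neqE)
qed

text \<open>Take the last mark up to \<open>2 * k - 1\<close> and the first mark from there on. If
  neither were odd, they would be distinct consecutive even marks; an odd one is the attachment
  point.\<close>

lemma nearest_exists:
  assumes alt: "alternating Y" and a: "a \<in> Y" "a \<le> 2 * k - 1" and b: "b \<in> Y" "2 * k - 1 \<le> b"
  shows "\<exists>t. nearest Y k t"
proof -
  let ?P = "Y \<inter> {a..2 * k - 1}" and ?Q = "Y \<inter> {2 * k - 1..b}"
  define p q where "p = Max ?P" and "q = Min ?Q"
  have P: "finite ?P" "a \<in> ?P" and Q: "finite ?Q" "b \<in> ?Q" using a b by auto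
  have p: "p \<in> Y" "p \<le> 2 * k - 1" "\<And>x. x \<in> Y \<Longrightarrow> p < x \<Longrightarrow> x \<le> 2 * k - 1 \<Longrightarrow> False"
  proof -
    have "p \<in> ?P" unfolding p_def using P by (intro Max_in) auto
    then show "p \<in> Y" "p \<le> 2 * k - 1" by auto
    fix x assume "x \<in> Y" "p < x" "x \<le> 2 * k - 1"
    then show False using Max_ge[OF P(1), of x] \<open>p \<in> ?P\<close> unfolding p_def[symmetric] by auto
  qed
  have q: "q \<in> Y" "2 * k - 1 \<le> q" "\<And>x. x \<in> Y \<Longrightarrow> x < q \<Longrightarrow> 2 * k - 1 \<le> x \<Longrightarrow> False"
  proof -
    have "q \<in> ?Q" unfolding q_def using Q by (intro Min_in) auto
    then show "q \<in> Y" "2 * k - 1 \<le> q" by auto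
    fix x assume "x \<in> Y" "x < q" "2 * k - 1 \<le> x"
    then show False using Min_le[OF Q(1), of x] \<open>q \<in> ?Q\<close> unfolding q_def[symmetric] by auto
  qed
  show ?thesis
  proof (cases p rule: slot_cases)
    case (2 t)
    then have "nearest Y k t" using p by (fastforce simp: nearest_def)
    then show ?thesis ..
  next
    case (1 i)
    show ?thesis
    proof (cases q rule: slot_cases)
      case (2 t)
      then have "nearest Y k t" using q by (fastforce simp: nearest_def)
      then show ?thesis ..
    next
      case q2: (1 j)
      have "p < q" "Y \<inter> {p<..<q} = {}"
        using 1 q2 p q by (presburger, force)
      then have "odd (q - p)" using alternatingD[OF alt] p q by blast
      then show ?thesis using 1 q2 by simp
    qed
  qed
qed

text \<open>The attachment point does not change across a rim edge in \<open>D\<close>. The critical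
  case is \<open>t \<le> k\<close>: a mark at \<open>2 * k + 1\<close> would be the next mark after
  \<open>2 * t - 1\<close>, also odd.\<close>

lemma nearest_step:
  assumes alt: "alternating Y" and "2 * k \<notin> Y" and t: "nearest Y k t"
  shows "nearest Y (k + 1) t"
proof (cases "t \<le> k")
  case True
  have "2 * k + 1 \<notin> Y"
  proof
    assume x: "2 * k + 1 \<in> Y"
    have "\<not> (2 * t - 1 < x \<and> x < 2 * k + 1)" if "x \<in> Y" for x
    proof -
      have "x \<noteq> 2 * k" using that assms by auto
      then show ?thesis using t that unfolding nearest_def by force
    qed
    then have "odd ((2 * k + 1) - (2 * t - 1))"
      using True t x by (intro alternatingD[OF alt]) (auto simp: nearest_def)
    then show False by simp
  qed
  then have "x \<noteq> 2 * k \<and> x \<noteq> 2 * k + 1" if "x \<in> Y" for x using that assms by auto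
  then show ?thesis using t True unfolding nearest_def by force
next
  case False
  then show ?thesis using t unfolding nearest_def by force
qed

context rooted_wheel
begin

text \<open>A function of the unrolled index descends to the vertices once it is invariant under
  full turns.\<close>

lemma rim_factor:
  assumes "\<And>k l. rim k = rim l \<Longrightarrow> g k = g l"
  shows "\<exists>f. f Center = c \<and> (\<forall>k. f (rim k) = g k)"
proof -
  let ?f = "\<lambda>v. if v = Center then c else g (SOME k. rim k = v)"
  have "?f (rim k) = g k" for k
    using assms[of "SOME l. rim l = rim k" k] someI[of "\<lambda>l. rim l = rim k" k] by simp
  then show ?thesis by (intro exI[of _ ?f]) simp
qed

lemma adjacent_cases:
  assumes sub: "D \<subseteq> edges W" and "adjacent (V, D) u v"
  obtains k where "{rim k, rim (k + 1)} \<in> D" "u = rim k" "v = rim (k + 1)"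
  | k where "{rim k, rim (k + 1)} \<in> D" "u = rim (k + 1)" "v = rim k"
  | k where "{Center, rim k} \<in> D" "u = Center" "v = rim k"
  | k where "{Center, rim k} \<in> D" "u = rim k" "v = Center"
proof -
  have uv: "{u, v} \<in> D" using assms by (simp add: adjacent_def)
  then obtain p where p: "{u, v} = slot N p"
    using assms edges_wheel_eq_range_slot[OF N_ge_1] by auto
  show ?thesis
    by (cases p rule: slot_cases)
      (use p uv that in \<open>auto simp: slot_even slot_odd doubleton_eq_iff insert_commute\<close>)
qed

text \<open>Everything is read off from the attachment point \<open>t k\<close>: a height function
  for acyclicity, a labelling by roots for uniqueness, and the rim path from \<open>k\<close> to
  \<open>t k\<close> for existence.\<close>

lemma forest_if_admissible:
  assumes "admissible D"
  shows "rooted_spanning_forest W ({Center} \<union> R) (V, D)"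
proof -
  let ?adj = "adjacent (V, D)" and ?Y = "marks N R D"
  have sub: "D \<subseteq> edges W" and noroot: "\<And>k. rim k \<in> R \<Longrightarrow> {Center, rim k} \<notin> D"
    and alt: "alternating ?Y"
    using assms by (auto simp: admissible_def)
  have root_mark: "2 * k - 1 \<in> ?Y" if "rim k \<in> R" for k
    using that by (simp add: mem_marks_odd)
  have "\<exists>t. nearest ?Y k t" for k
  proof -
    obtain i where i: "k - 1 - int N < i" "i \<le> k - 1 - int N + int N" "rim i \<in> R" by (rule root_in_window)
    obtain j where j: "k < j" "j \<le> k + int N" "rim j \<in> R" by (rule root_in_window)
    show ?thesis
      using i j by (intro nearest_exists[OF alt root_mark[of i] _ root_mark[of j]]) auto
  qed
  then obtain t where t: "\<And>k. nearest ?Y k (t k)" by metis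
  have t_eq: "t k = s" if "nearest ?Y k s" for k s
    using nearest_unique[OF alt t that] .
  have t_step: "t (k + 1) = t k" if "2 * k \<notin> ?Y" for k
    by (rule t_eq) (rule nearest_step[OF alt that t])
  have t_self: "t k = k" if "2 * k - 1 \<in> ?Y" for k
    by (rule t_eq) (use that in \<open>auto simp: nearest_def\<close>)
  \<comment> \<open>Turning round shifts attachment points along, so \<open>k - t k\<close> and
    \<open>rim (t k)\<close> depend only on the vertex.\<close>
  have t_shift: "t l = t k + (l - k)" if "rim k = rim l" for k l
  proof -
    have "int N dvd l - k" using that[symmetric] by (simp add: rim_eq_iff)
    then obtain m where "l - k = int N * m" by (elim dvdE)
    then have m: "l = k + int N * m" by simp
    have per: "x \<in> ?Y \<longleftrightarrow> x - 2 * int N * m \<in> ?Y" for x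
      using marks_periodic[OF N_ge_3, of x "- m" R D] by simp
    have "nearest ?Y l (t k + int N * m)"
      unfolding nearest_def
    proof (intro conjI ballI)
      show "2 * (t k + int N * m) - 1 \<in> ?Y"
        using t[of k] by (subst per) (simp add: nearest_def algebra_simps)
      fix x assume "x \<in> ?Y"
      then have x: "x - 2 * int N * m \<in> ?Y" using per by simp
      show "\<not> (2 * (t k + int N * m) - 1 < x \<and> x \<le> 2 * l - 1)"
        "\<not> (2 * l - 1 \<le> x \<and> x < 2 * (t k + int N * m) - 1)"
        using t[of k] x unfolding nearest_def m by (auto simp: algebra_simps)
    qed
    then show ?thesis using t_eq m by simp
  qed
  \<comment> \<open>\<open>h\<close> is the distance to the centre along the rim arc, a root counting as if attached to it.\<close>
  have "\<exists>h. h Center = (0::nat) \<and> (\<forall>k. h (rim k) = nat \<bar>k - t k\<bar> + 1)"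
  proof (rule rim_factor)
    show "nat \<bar>k - t k\<bar> + 1 = nat \<bar>l - t l\<bar> + 1" if "rim k = rim l" for k l
      using t_shift[OF that] by simp
  qed
  then obtain h where h: "h Center = (0::nat)" "\<And>k. h (rim k) = nat \<bar>k - t k\<bar> + 1"
    by blast
  \<comment> \<open>This label is constant along edges and fixes every root, so two different roots
    cannot be connected.\<close>
  have "\<exists>root. root Center = Center \<and>
    (\<forall>k. root (rim k) = (if rim (t k) \<in> R then rim (t k) else Center))"
  proof (rule rim_factor)
    fix k l assume kl: "rim k = rim l"
    then have "rim (t l) = rim (t k)"
      using t_shift[OF kl] by (simp add: rim_eq_iff dvd_diff_commute)
    then show "(if rim (t k) \<in> R then rim (t k) else Center) = (if rim (t l) \<in> R then rim (t l) else Center)"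
      by simp
  qed
  then obtain root where root: "root Center = Center"
    "\<And>k. root (rim k) = (if rim (t k) \<in> R then rim (t k) else Center)"
    by blast
  have edge: "t (k + 1) = t k" if "{rim k, rim (k + 1)} \<in> D" for k
    using t_step that by (simp add: mem_marks_even)
  have spoke: "t k = k" "rim k \<notin> R" if "{Center, rim k} \<in> D" for k
    using t_self noroot that by (auto simp: mem_marks_odd)
  have acyclic: "acyclic_graph (V, D)"
  proof (rule acyclic_graph_if_height[where h = h])
    show "h u \<noteq> h v" if "?adj u v" for u v
      using sub that
      by (rule adjacent_cases) (use h edge in \<open>auto simp: nat_eq_iff2 eq_nat_nat_iff split: abs_split\<close>)
    fix u v w assume adj: "?adj u v" "?adj u w" and lower: "h v < h u" "h w < h u"
    obtain k where u: "u = rim k"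
      using adj(1) lower h by (elim adjacent_cases[OF sub]) auto
    \<comment> \<open>The only lower neighbour is one step towards the attachment point, or
      \<open>Center\<close> for a vertex that is its own attachment point.\<close>
    have low: "v = Center \<and> t k = k \<or> v = rim (k + sgn (t k - k)) \<and> t k \<noteq> k"
      if "?adj u v" "h v < h u" for v
    proof (rule neighbour_cases[OF sub])
      show e: "{rim k, v} \<in> D" using that u by (simp add: adjacent_def)
      { assume "v = Center"
        then show ?thesis using e spoke by (auto simp: insert_commute) }
      { assume v: "v = rim (k + 1)"
        then have "t (k + 1) = t k" using e edge by simp
        then show ?thesis using that u v h by (auto simp: sgn_if split: abs_split) }
      { assume v: "v = rim (k - 1)"
        then have "t (k - 1) = t k" using e edge[of "k - 1"] by (simp add: insert_commute)
        then show ?thesis using that u v h by (auto simp: sgn_if split: abs_split) }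
    qed
    show "v = w" using low[OF adj(1) lower(1)] low[OF adj(2) lower(2)] by auto
  qed
  have same_root: "root u = root v" if "?adj u v" for u v
    using sub that by (rule adjacent_cases) (use root edge spoke in auto)
  have same: "root u = root v" if "?adj\<^sup>*\<^sup>* u v" for u v
    using that by (induction rule: rtranclp_induct) (auto dest: same_root)
  have root_self: "root s = s" if "s \<in> {Center} \<union> R" for s
  proof (cases "s = Center")
    case False
    then have "s \<in> R" using that by simp
    moreover then have "s \<in> range rim"
      using R_subset range_rim_at[OF N_ge_1] by auto
    ultimately obtain k where k: "s = rim k" "rim k \<in> R" by auto
    then show ?thesis using root root_mark t_self by simp
  qed (simp add: root)
  have "\<exists>s\<in>{Center} \<union> R. ?adj\<^sup>*\<^sup>* v s" if "v \<in> V" for v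
  proof (cases "v = Center")
    case False
    then obtain k where k: "v = rim k" using \<open>v \<in> V\<close> by (auto simp: V_eq)
    have near: "2 * t k - 1 \<in> ?Y" "\<And>x. x \<in> ?Y \<Longrightarrow> \<not> (2 * t k - 1 < x \<and> x \<le> 2 * k - 1)"
      "\<And>x. x \<in> ?Y \<Longrightarrow> \<not> (2 * k - 1 \<le> x \<and> x < 2 * t k - 1)"
      using t[of k] by (auto simp: nearest_def)
    have "?adj\<^sup>*\<^sup>* (rim k) (rim (t k))"
    proof (cases "k \<le> t k")
      case True
      then show ?thesis by (rule reach_along_rim) (use near(3) in force)
    next
      case False
      have "?adj\<^sup>*\<^sup>* (rim (t k)) (rim k)"
        by (rule reach_along_rim) (use False near(2) in force)+
      then show ?thesis by (rule reach_sym)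
    qed
    moreover have "rim (t k) \<in> R \<or> ?adj (rim (t k)) Center"
      using near(1) by (auto simp: mem_marks_odd adjacent_def insert_commute)
    ultimately show ?thesis
      unfolding k by (meson UnCI insertI1 rtranclp.rtrancl_into_rtrancl)
  qed auto
  then show ?thesis
    unfolding rooted_spanning_forest_iff
    using sub acyclic same root_self by (intro exI[of _ D]) (auto, metis+)
qed

lemma rooted_spanning_forest_iff_admissible:
  "rooted_spanning_forest W ({Center} \<union> R) F \<longleftrightarrow> (\<exists>D. F = (V, D) \<and> admissible D)"
proof
  assume "rooted_spanning_forest W ({Center} \<union> R) F"
  then obtain D where "F = (V, D)" "D \<subseteq> edges W" "acyclic_graph (V, D)"
    "\<forall>s\<in>{Center} \<union> R. \<forall>t\<in>{Center} \<union> R. (adjacent (V, D))\<^sup>*\<^sup>* s t \<longrightarrow> s = t"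
    "\<forall>v\<in>V. \<exists>s\<in>{Center} \<union> R. (adjacent (V, D))\<^sup>*\<^sup>* v s"
    unfolding rooted_spanning_forest_iff by auto
  then show "\<exists>D. F = (V, D) \<and> admissible D"
    by (intro exI[of _ D] conjI admissible_if_forest) blast+
next
  show "rooted_spanning_forest W ({Center} \<union> R) F" if "\<exists>D. F = (V, D) \<and> admissible D"
    using that forest_if_admissible by auto
qed

end

section \<open>Splitting into the cyclic intervals\<close>

context rooted_wheel
begin

abbreviation "r \<equiv> card R"

definition start :: "nat \<Rightarrow> int" where
  "start i = int (rim_index R i)"

text \<open>For the last interval this is the first root one turn later, not its index reduced to
  \<open>1, ..., N\<close>, so all intervals run upwards.\<close>

definition stop :: "nat \<Rightarrow> int" where
  "stop i = start i + int (cyclic_interval N R i)"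

text \<open>The ends are the spoke positions of two successive roots and are left out, which
  accounts for the size \<open>2 * d - 1\<close>.\<close>

definition block :: "nat \<Rightarrow> int set" where
  "block i = {2 * start i - 1<..<2 * stop i - 1}"

definition slots :: "int set" where
  "slots = (\<Union>i\<in>{1..r}. block i)"

lemma root_indices: "{j. Rim j \<in> R} \<subseteq> {1..N}" "finite {j. Rim j \<in> R}" "card {j. Rim j \<in> R} = r"
proof -
  show sub: "{j. Rim j \<in> R} \<subseteq> {1..N}" using R_subset by (auto simp: rim_vertices_def)
  then show "finite {j. Rim j \<in> R}" by (rule finite_subset) simp
  have "R = Rim ` {j. Rim j \<in> R}" using R_subset by (auto simp: rim_vertices_def)
  then show "card {j. Rim j \<in> R} = r"
    by (metis (no_types, lifting) card_image inj_onI wheel_vertex.inject)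
qed

lemma r_ge_1: "r \<ge> 1"
proof -
  have "finite R" using R_subset by (rule finite_subset) (simp add: rim_vertices_def)
  then show ?thesis using R_nonempty by (simp add: Suc_le_eq card_gt_0_iff)
qed

lemma start_less: "\<lbrakk>1 \<le> i; i < j; j \<le> r\<rbrakk> \<Longrightarrow> start i < start j"
  using strict_sorted_list_of_set[of "{j. Rim j \<in> R}"] root_indices
  by (auto simp: start_def rim_index_def sorted_wrt_iff_nth_less)

lemma start_image: "start ` {1..r} = int ` {j. Rim j \<in> R}"
proof -
  let ?xs = "sorted_list_of_set {j. Rim j \<in> R}"
  have "rim_index R ` {1..r} = (\<lambda>i. ?xs ! i) ` {0..<r}"
  proof -
    have "{1..r} = Suc ` {0..<r}" by (simp only: image_Suc_atLeastLessThan atLeastLessThanSuc_atLeastAtMost One_nat_def)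
    then show ?thesis by (simp only: rim_index_def image_image diff_Suc_1)
  qed
  also have "\<dots> = set ?xs"
    using root_indices by (auto simp: set_conv_nth)
  finally show ?thesis using root_indices by (simp add: start_def flip: image_image)
qed

lemma start_bounds: "i \<in> {1..r} \<Longrightarrow> 1 \<le> start i \<and> start i \<le> int N \<and> rim (start i) \<in> R"
proof -
  assume "i \<in> {1..r}"
  then obtain j where "start i = int j" "Rim j \<in> R" using start_image by blast
  then show ?thesis using root_indices(1) rim_at_int[of j N] by auto
qed

lemma stop_eq: "i \<in> {1..r} \<Longrightarrow> stop i = (if i < r then start (i + 1) else start 1 + int N)"
  using start_less[of i "i + 1"] start_bounds[of i]
  by (auto simp: stop_def cyclic_interval_def start_def of_nat_diff)

lemma start_less_stop: "i \<in> {1..r} \<Longrightarrow> start i < stop i"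
  using start_less[of i "i + 1"] start_bounds[of i] start_bounds[of 1] r_ge_1
  by (auto simp: stop_eq)

lemma root_stop: "i \<in> {1..r} \<Longrightarrow> rim (stop i) \<in> R"
  using start_bounds[of "i + 1"] start_bounds[of 1] r_ge_1 by (auto simp: stop_eq)

lemma start_mono: "\<lbrakk>1 \<le> i; i \<le> j; j \<le> r\<rbrakk> \<Longrightarrow> start i \<le> start j"
  using start_less[of i j] by (cases "i = j") auto

lemma stop_le_start: "\<lbrakk>1 \<le> i; i < j; j \<le> r\<rbrakk> \<Longrightarrow> stop i \<le> start j"
  using start_mono[of "i + 1" j] by (simp add: stop_eq)

lemma stop_le: "i \<in> {1..r} \<Longrightarrow> stop i \<le> start 1 + int N"
  using start_bounds[of "i + 1"] start_bounds[of 1] r_ge_1 by (auto simp: stop_eq)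

lemma no_root_inside:
  assumes "i \<in> {1..r}" "start i < k" "k < stop i"
  shows "rim k \<notin> R"
proof
  assume "rim k \<in> R"
  \<comment> \<open>Only the last interval can pass \<open>N\<close>. Its indices beyond
    \<open>N\<close> come back below the first root, where no root lies.\<close>
  define l where "l = (if k \<le> int N then k else k - int N)"
  have k: "1 \<le> k" "k < start 1 + int N" "start 1 \<le> int N"
    using assms start_bounds[of i] stop_le[of i] start_bounds[of 1] r_ge_1 by auto
  have l: "1 \<le> l" "l \<le> int N" "rim l = rim k"
    using k by (auto simp: l_def rim_eq_iff)
  have "rim l = Rim (nat l)"
    using l(1,2) rim_at_int[of "nat l" N] by (simp add: nat_le_iff le_nat_iff)
  then have "l \<in> int ` {j. Rim j \<in> R}"
    using l \<open>rim k \<in> R\<close> by (intro image_eqI[of _ _ "nat l"]) auto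
  then obtain j where j: "j \<in> {1..r}" "l = start j"
    unfolding start_image[symmetric] by auto
  show False
  proof (cases "k \<le> int N")
    case True
    then have "k = start j" using j by (simp add: l_def)
    then show False
      using assms j start_mono[of j i] stop_le_start[of i j] by (cases "j \<le> i") auto
  next
    case False
    then have "l < start 1" using k by (simp add: l_def)
    then show False using j start_mono[of 1 j] by auto
  qed
qed

lemma window_cases:
  assumes "start 1 \<le> k" "k < start 1 + int N"
  obtains i where "i \<in> {1..r}" "start i \<le> k" "k < stop i"
proof -
  let ?I = "{i \<in> {1..r}. start i \<le> k}"
  have fin: "finite ?I" and "1 \<in> ?I" using assms r_ge_1 by auto
  then have "Max ?I \<in> ?I" by (intro Max_in) auto
  moreover have "k < stop (Max ?I)"
  proof (cases "Max ?I < r")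
    case True
    have "Max ?I + 1 \<notin> ?I"
    proof
      assume "Max ?I + 1 \<in> ?I"
      from Max_ge[OF fin this] show False by simp
    qed
    then show ?thesis using True \<open>Max ?I \<in> ?I\<close> stop_eq[of "Max ?I"] by auto
  next
    case False
    then show ?thesis using \<open>Max ?I \<in> ?I\<close> stop_eq[of "Max ?I"] assms by auto
  qed
  ultimately show ?thesis using that by blast
qed

text \<open>The blocks together with their left ends tile one turn, beginning at the spoke of the
  first root; \<open>m\<close> is the number of turns that moves \<open>p\<close> there.\<close>

lemma shift_into_closed_block:
  obtains i m where "i \<in> {1..r}" "2 * start i - 1 \<le> p + 2 * int N * m" "p + 2 * int N * m < 2 * stop i - 1"
proof -
  let ?c = "2 * start 1 - 1"
  define m where "m = - ((p - ?c) div (2 * int N))"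
  let ?p = "p + 2 * int N * m"
  have "?p = ?c + (p - ?c) mod (2 * int N)"
    using mult_div_mod_eq[of "2 * int N" "p - ?c"] unfolding m_def mult_minus_right by linarith
  then have p: "?c \<le> ?p" "?p < ?c + 2 * int N"
    using N_ge_1 by auto
  obtain k where k: "?p = 2 * k \<or> ?p = 2 * k - 1"
    by (metis slot_cases)
  then have "start 1 \<le> k" "k < start 1 + int N" using p by auto
  then obtain i where "i \<in> {1..r}" "start i \<le> k" "k < stop i" by (rule window_cases)
  then show ?thesis using k that[of i m] by auto
qed

lemma disjoint_blocks: "disjoint_family_on block {1..r}"
proof -
  have "block i \<inter> block j = {}" if "i < j" "i \<in> {1..r}" "j \<in> {1..r}" for i j
    using stop_le_start[of i j] that by (auto simp: block_def)
  then show ?thesis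
    unfolding disjoint_family_on_def by (metis Int_commute linorder_neqE_nat)
qed

lemma inj_on_slot_slots: "inj_on (slot N) slots"
proof (rule inj_onI)
  have bounds: "2 * start 1 - 1 < p \<and> p < 2 * start 1 - 1 + 2 * int N" if p: "p \<in> slots" for p
  proof -
    obtain i where "i \<in> {1..r}" "p \<in> block i" using p by (auto simp: slots_def)
    then show ?thesis using start_mono[of 1 i] stop_le[of i] by (auto simp: block_def)
  qed
  fix p q assume "p \<in> slots" "q \<in> slots" "slot N p = slot N q"
  then have "2 * int N dvd p - q" "\<bar>p - q\<bar> < 2 * int N"
    using bounds[of p] bounds[of q] slot_eq_iff[OF N_ge_3] by auto
  then show "p = q"
    using zdvd_not_zless[of "\<bar>p - q\<bar>" "2 * int N"] by auto
qed

lemma no_root_slot: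
  assumes "2 * k - 1 \<in> slots" shows "rim k \<notin> R"
proof -
  obtain i where "i \<in> {1..r}" "2 * k - 1 \<in> block i" using assms by (auto simp: slots_def)
  then show ?thesis by (intro no_root_inside[of i]) (auto simp: block_def)
qed

text \<open>Out of one full turn, \<open>slots\<close> omits exactly the spokes at the
  roots.\<close>

lemma slot_image_slots:
  "D \<subseteq> slot N ` slots \<longleftrightarrow> D \<subseteq> edges W \<and> (\<forall>k. rim k \<in> R \<longrightarrow> {Center, rim k} \<notin> D)"
proof (intro iffI conjI allI impI)
  assume D: "D \<subseteq> slot N ` slots"
  then show "D \<subseteq> edges W" using edges_wheel_eq_range_slot[OF N_ge_1] by auto
  fix k assume "rim k \<in> R"
  show "{Center, rim k} \<notin> D"
  proof
    assume "{Center, rim k} \<in> D"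
    then obtain p where p: "p \<in> slots" "{Center, rim k} = slot N p" using D by auto
    show False
    proof (cases p rule: slot_cases)
      case (2 l)
      then show False using p no_root_slot \<open>rim k \<in> R\<close> by (auto simp: slot_odd doubleton_eq_iff)
    qed (use p in \<open>auto simp: slot_even doubleton_eq_iff\<close>)
  qed
next
  assume R: "D \<subseteq> edges W \<and> (\<forall>k. rim k \<in> R \<longrightarrow> {Center, rim k} \<notin> D)"
  show "D \<subseteq> slot N ` slots"
  proof
    fix e assume "e \<in> D"
    then obtain p where p: "e = slot N p"
      using R edges_wheel_eq_range_slot[OF N_ge_1] by auto
    obtain i m where im: "i \<in> {1..r}" "2 * start i - 1 \<le> p + 2 * int N * m"
      "p + 2 * int N * m < 2 * stop i - 1"
      by (rule shift_into_closed_block)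
    have e: "e = slot N (p + 2 * int N * m)"
      unfolding p slot_eq_iff[OF N_ge_3] by simp
    \<comment> \<open>The left end is the spoke of a root, which \<open>D\<close> does not contain;
      every other position of the tile is in the open block.\<close>
    have "p + 2 * int N * m \<noteq> 2 * start i - 1"
    proof
      assume "p + 2 * int N * m = 2 * start i - 1"
      then show False using R e \<open>e \<in> D\<close> start_bounds[OF im(1)] by (auto simp: slot_odd)
    qed
    then have "p + 2 * int N * m \<in> slots" using im unfolding slots_def by (intro UN_I[OF im(1)]) (simp add: block_def)
    then show "e \<in> slot N ` slots" using e by blast
  qed
qed

lemma mem_marks_slots:
  assumes "p \<in> slots" shows "p \<in> marks N R D \<longleftrightarrow> (even p \<longleftrightarrow> slot N p \<notin> D)"
proof (cases p rule: slot_cases)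
  case (1 k)
  then show ?thesis by (simp add: mem_marks_even slot_even)
next
  case (2 k)
  then show ?thesis using assms no_root_slot[of k] by (auto simp: mem_marks_odd slot_odd)
qed

text \<open>Away from the root spokes, marking keeps spokes and complements rim edges, so the same
  rule recovers \<open>D\<close> from its marks.\<close>

lemma bij_betw_marks: "bij_betw (\<lambda>D. marks N R D \<inter> slots) (Pow (slot N ` slots)) (Pow slots)"
proof (rule bij_betw_byWitness[where f' = "\<lambda>Z. slot N ` {p \<in> slots. even p \<longleftrightarrow> p \<notin> Z}"])
  show "\<forall>D\<in>Pow (slot N ` slots). slot N ` {p \<in> slots. even p \<longleftrightarrow> p \<notin> marks N R D \<inter> slots} = D"
    using mem_marks_slots by auto
  have "slot N p \<in> slot N ` {p \<in> slots. even p \<longleftrightarrow> p \<notin> Z} \<longleftrightarrow> (even p \<longleftrightarrow> p \<notin> Z)"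
    if "p \<in> slots" for p Z
    using that inj_onD[OF inj_on_slot_slots] by auto
  then show "\<forall>Z\<in>Pow slots. marks N R (slot N ` {p \<in> slots. even p \<longleftrightarrow> p \<notin> Z}) \<inter> slots = Z"
    by (auto simp: mem_marks_slots)
qed auto

definition block_alternating :: "nat \<Rightarrow> int set \<Rightarrow> bool" where
  "block_alternating i X \<longleftrightarrow> alternating (insert (2 * stop i - 1) (insert (2 * start i - 1) X))"

text \<open>The block ends are roots and hence always marked, so no pair of consecutive marks
  straddles one; after whole turns every such pair lies in a single block with its ends.\<close>

lemma alternating_marks_iff:
  "alternating (marks N R D) \<longleftrightarrow> (\<forall>i\<in>{1..r}. block_alternating i (marks N R D \<inter> block i))"
proof -
  let ?Y = "marks N R D"
  define closed where "closed i = ?Y \<inter> {2 * start i - 1..2 * stop i - 1}" for i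
  have ends: "2 * start i - 1 \<in> ?Y" "2 * stop i - 1 \<in> ?Y" if "i \<in> {1..r}" for i
    using that start_bounds root_stop by (auto simp: mem_marks_odd)
  have "insert (2 * stop i - 1) (insert (2 * start i - 1) (?Y \<inter> block i)) = closed i"
    if "i \<in> {1..r}" for i
    using ends[OF that] start_less_stop[OF that] by (auto simp: block_def closed_def)
  then have "(\<forall>i\<in>{1..r}. block_alternating i (?Y \<inter> block i)) \<longleftrightarrow> (\<forall>i\<in>{1..r}. alternating (closed i))"
    by (simp add: block_alternating_def)
  moreover have "alternating ?Y \<longleftrightarrow> (\<forall>i\<in>{1..r}. alternating (closed i))"
  proof (intro iffI ballI)
    fix i assume alt: "alternating ?Y" and "i \<in> {1..r}"
    show "alternating (closed i)"
      unfolding alternating_def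
    proof (intro ballI impI)
      fix p q assume "p \<in> closed i" "q \<in> closed i" "p < q \<and> closed i \<inter> {p<..<q} = {}"
      then show "odd (q - p)"
        by (intro alternatingD[OF alt]) (force simp: closed_def)+
    qed
  next
    assume alt: "\<forall>i\<in>{1..r}. alternating (closed i)"
    show "alternating ?Y"
      unfolding alternating_def
    proof (intro ballI impI)
      fix p q assume pq: "p \<in> ?Y" "q \<in> ?Y" "p < q \<and> ?Y \<inter> {p<..<q} = {}"
      obtain i m where im: "i \<in> {1..r}" "2 * start i - 1 \<le> p + 2 * int N * m"
        "p + 2 * int N * m < 2 * stop i - 1"
        by (rule shift_into_closed_block)
      let ?s = "2 * int N * m"
      have per: "x \<in> ?Y \<longleftrightarrow> x - ?s \<in> ?Y" for x
        using marks_periodic[OF N_ge_3, of x "- m" R D] by simp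
      have "p + ?s \<in> ?Y" "q + ?s \<in> ?Y" using pq per[of "p + ?s"] per[of "q + ?s"] by simp_all
      have gap: "?Y \<inter> {p + ?s<..<q + ?s} = {}"
      proof -
        have "x - ?s \<notin> {p<..<q}" if "x \<in> ?Y" for x using that pq per[of x] by blast
        then show ?thesis by force
      qed
      \<comment> \<open>Otherwise the mark at the right end of the block would lie strictly between
        the two.\<close>
      then have "q + ?s \<le> 2 * stop i - 1"
        using ends(2)[OF im(1)] im(3) by (auto simp: not_less)
      then have "p + ?s \<in> closed i" "q + ?s \<in> closed i" "closed i \<inter> {p + ?s<..<q + ?s} = {}"
        using \<open>p + ?s \<in> ?Y\<close> \<open>q + ?s \<in> ?Y\<close> im pq gap by (auto simp: closed_def)
      moreover have "alternating (closed i)" using alt im by blast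
      ultimately have "odd ((q + ?s) - (p + ?s))"
        using pq by (intro alternatingD[of "closed i"]) auto
      then show "odd (q - p)" by simp
    qed
  qed
  ultimately show ?thesis by simp
qed

lemma num_rooted_forests_wheel:
  "num_rooted_forests W ({Center} \<union> R) =
    (\<Prod>i = 1..r. num_matchings (path_graph (2 * cyclic_interval N R i - 1)))"
proof -
  have "{F. rooted_spanning_forest W ({Center} \<union> R) F} = Pair V ` {D. admissible D}"
    unfolding rooted_spanning_forest_iff_admissible by auto
  then have "num_rooted_forests W ({Center} \<union> R) = card {D. admissible D}"
    by (simp add: num_rooted_forests_def card_image inj_on_def)
  also have "{D. admissible D} =
      {D \<in> Pow (slot N ` slots). \<forall>i\<in>{1..r}. block_alternating i (marks N R D \<inter> slots \<inter> block i)}"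
  proof -
    have "marks N R D \<inter> slots \<inter> block i = marks N R D \<inter> block i" if "i \<in> {1..r}" for D i
      using that by (auto simp: slots_def)
    then show ?thesis
      by (auto simp: admissible_def slot_image_slots alternating_marks_iff)
  qed
  also have "card \<dots> = card {Z \<in> Pow slots. \<forall>i\<in>{1..r}. block_alternating i (Z \<inter> block i)}"
    by (rule bij_betw_same_card, rule bij_betw_Collect[OF bij_betw_marks]) simp
  also have "\<dots> = (\<Prod>i = 1..r. card {X. X \<subseteq> block i \<and> block_alternating i X})"
    using card_blockwise_subsets[OF _ disjoint_blocks] by (simp add: slots_def block_def)
  also have "\<dots> = (\<Prod>i = 1..r. num_matchings (path_graph (2 * cyclic_interval N R i - 1)))"
  proof (rule prod.cong)
    fix i assume i: "i \<in> {1..r}"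
    let ?n = "2 * cyclic_interval N R i - 1"
    \<comment> \<open>Makes the truncated subtraction in
      \<open>2 * cyclic_interval N R i - 1\<close> a true one.\<close>
    have "cyclic_interval N R i \<ge> 1" using start_less_stop[OF i] by (simp add: stop_def)
    then have "2 * stop i - 1 = (2 * start i - 1) + int ?n + 1"
      by (simp add: stop_def of_nat_diff)
    then show "card {X. X \<subseteq> block i \<and> block_alternating i X} = num_matchings (path_graph ?n)"
      using card_alternating_between[of "2 * start i - 1" ?n]
      by (simp only: block_def block_alternating_def)
  qed simp
  finally show ?thesis .
qed

end

theorem corollary3p7:
  fixes N r :: nat and R :: "wheel_vertex set"
  assumes "N \<ge> 3" and "1 \<le> r" and "r \<le> N"
    and "R \<subseteq> rim_vertices N" and "card R = r"
  shows "num_rooted_forests (wheel_graph N) ({Center} \<union> R) =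
           (\<Prod>i = 1..r. num_matchings (path_graph (2 * cyclic_interval N R i - 1)))"
proof -
  interpret rooted_wheel N R
    using assms by unfold_locales auto
  show ?thesis using num_rooted_forests_wheel assms by simp
qed

end
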